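(* Let $\lambda>0$ and let $\mu=\Pi^{1}_{0,\lambda}$ (the conditionally free Poisson distribution whose reference measure $\nu$ is the semicircle law of mean $\lambda$ and variance $\lambda$). For every integer $n\ge1$, the $n$-th moment $m_n(\mu)$ of $\mu$ is given by $$m_n(\mu)=\sum_{\pi}\Biggl(\prod_{B\in\pi,\ |B|=1,2}\lambda\Biggr)\Biggl(\prod_{\substack{B\in\pi,\ |B|\ge3\\ B\ \mathrm{outer}}}\lambda\Biggr)=\sum_{\pi}\Biggl(\prod_{\substack{B\in\pi,\ |B|=1,2\\ B\ \mathrm{inner}}}\lambda\Biggr)\Biggl(\prod_{B\in\pi,\ B\ \mathrm{outer}}\lambda\Biggr),$$ where both sums run over all non-crossing partitions $\pi\in\mathcal{NC}(n)$ having no inner block of size $\ge3$. Equivalently, $$m_n(\mu)=\sum_{k=1}^{n}\#\bigl(\mathcal{NC}_{1,2:\mathrm{inner}}(n,k)\bigr)\,\lambda^k .$$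
   Context: The measure $\mu=\Pi^{1}_{0,\lambda}$ is the compactly supported orthogonalizing probability measure on $\mathbb{R}$ of the polynomials determined by $C_0(x)=1$, $C_1(x)=x-\lambda$, $C_2(x)=(x-(\lambda+1))C_1(x)-\lambda C_0(x)$, and $C_{n+1}(x)=(x-\lambda)C_n(x)-\lambda C_{n-1}(x)$ for $n\ge2$. Its moments are $m_n(\mu)=\int_{\mathbb{R}}x^n\,d\mu(x)$. Equivalently, $m_n(\mu)=\varphi\bigl((\boldsymbol{P}^{1}_{0,\lambda})^n\bigr)=((\boldsymbol{P}^{1}_{0,\lambda})^n\Omega\,|\,\Omega)$, where on the Hilbert space with orthonormal basis $\xi^{\otimes m}$, $m\ge0$ ($\xi^{\otimes0}=\Omega$), $\boldsymbol{P}^{1}_{0,\lambda}=m_0+\sqrt\lambda(a^\dagger+a)+\lambda I$ with $a^\dagger\xi^{\otimes m}=\xi^{\otimes(m+1)}$, $a=(a^\dagger)^*$, $m_0\xi=\xi$ and $m_0\xi^{\otimes m}=0$ for $m\ne1$. Partitions: $\mathcal{NC}(n)$ is the set of non-crossing partitions of $[n]=\{1,\dots,n\}$, i.e. set partitions with no two distinct blocks $B_i\ne B_j$ and elements $b_1,b_2\in B_i$, $c_1,c_2\in B_j$ such that $b_1<c_1<b_2<c_2$. $|B|$ is the size of a block $B$. A block $C$ covers $a\in[n]$ if $a\notin C$ and $\min C\le a\le\max C$. In a non-crossing partition, all elements of a block $B$ are covered by the same number of blocks, and this number is the depth $\mathrm{dp}(B)$. A block $B$ is outer if $\mathrm{dp}(B)=0$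 and inner if $\mathrm{dp}(B)\ge1$. $\mathcal{NC}_{1,2:\mathrm{inner}}(n,k)$ is the set of non-crossing partitions of $[n]$ with exactly $k$ blocks such that only blocks of size $1$ and $2$ are allowed to be inner (i.e. every block of size $\ge3$ is outer). Empty products equal $1$. *)

theory Defs
  imports
    "HOL-Probability.Probability"
    "HOL-Computational_Algebra.Polynomial"
    "HOL-Library.Disjoint_Sets"
begin

fun cpoly :: "real \<Rightarrow> nat \<Rightarrow> real poly" where
  "cpoly l 0 = 1"
| "cpoly l (Suc 0) = [:- l, 1:]"
| "cpoly l (Suc (Suc 0)) = [:- (l + 1), 1:] * cpoly l (Suc 0) - smult l (cpoly l 0)"
| "cpoly l (Suc (Suc (Suc n))) =
     [:- l, 1:] * cpoly l (Suc (Suc n)) - smult l (cpoly l (Suc n))"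

definition compactly_supported :: "real measure \<Rightarrow> bool" where
  "compactly_supported M \<longleftrightarrow> (\<exists>K. compact K \<and> (AE x in M. x \<in> K))"

definition orthogonalizing :: "real measure \<Rightarrow> (nat \<Rightarrow> real poly) \<Rightarrow> bool" where
  "orthogonalizing M p \<longleftrightarrow>
     (\<forall>i j. i \<noteq> j \<longrightarrow> (\<integral>x. poly (p i) x * poly (p j) x \<partial>M) = 0)"

text \<open>For \<open>l > 0\<close> exactly one measure has this property: it exists because the recurrence of
  \<open>cpoly\<close> has bounded coefficients (Favard), and the orthogonality relations determine all moments,
  which determine a compactly supported measure. All integrals of polynomials exist by compactness of the
  support, and orthogonality together with the recurrence makes the squared norm of the
  polynomial number \<open>n\<close> equal to \<open>l ^ n\<close>.\<close>
definition is_cfree_poisson :: "real \<Rightarrow> real measure \<Rightarrow> bool" where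
  "is_cfree_poisson l M \<longleftrightarrow>
     real_distribution M \<and> compactly_supported M \<and> orthogonalizing M (cpoly l)"

definition moment :: "real measure \<Rightarrow> nat \<Rightarrow> real" where
  "moment M n = (\<integral>x. x ^ n \<partial>M)"

definition noncrossing :: "nat set set \<Rightarrow> bool" where
  "noncrossing P \<longleftrightarrow>
     \<not> (\<exists>B\<in>P. \<exists>C\<in>P. B \<noteq> C \<and>
          (\<exists>b1\<in>B. \<exists>b2\<in>B. \<exists>c1\<in>C. \<exists>c2\<in>C. b1 < c1 \<and> c1 < b2 \<and> b2 < c2))"

definition NC :: "nat \<Rightarrow> nat set set set" where
  "NC n = {P. partition_on {1..n} P \<and> noncrossing P}"

definition covers :: "nat set \<Rightarrow> nat \<Rightarrow> bool" where
  "covers C a \<longleftrightarrow> a \<notin> C \<and> Min C \<le> a \<and> a \<le> Max C"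

text \<open>For blocks of a non-crossing partition the description is proper, see \<open>depth_eq\<close> below.\<close>
definition depth :: "nat set set \<Rightarrow> nat set \<Rightarrow> nat" where
  "depth P B = (THE d. \<forall>a\<in>B. card {C \<in> P. covers C a} = d)"

definition outer_block :: "nat set set \<Rightarrow> nat set \<Rightarrow> bool" where
  "outer_block P B \<longleftrightarrow> depth P B = 0"

definition inner_block :: "nat set set \<Rightarrow> nat set \<Rightarrow> bool" where
  "inner_block P B \<longleftrightarrow> depth P B \<ge> 1"

definition NC_12_inner :: "nat \<Rightarrow> nat \<Rightarrow> nat set set set" where
  "NC_12_inner n k =
     {P \<in> NC n. card P = k \<and> (\<forall>B\<in>P. inner_block P B \<longrightarrow> card B = 1 \<or> card B = 2)}"

lemma covers_block_mono:
  assumes P: "P \<in> NC n" and B: "B \<in> P" "a \<in> B" "b \<in> B" and C: "C \<in> P" "covers C a"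
  shows "covers C b"
proof -
  have part: "partition_on {1..n} P" and nc: "noncrossing P"
    using P by (auto simp: NC_def)
  have sub: "C \<subseteq> {1..n}"
    using part C(1) by (auto simp: partition_on_def)
  have fin: "finite C"
    using sub by (rule finite_subset) simp
  have ne: "C \<noteq> {}"
    using part C(1) by (auto simp: partition_on_def)
  have mem: "Min C \<in> C" "Max C \<in> C"
    using fin ne by auto
  have "B \<noteq> C"
    using B C by (auto simp: covers_def)
  then have disj: "B \<inter> C = {}"
    using part B(1) C(1) by (auto simp: partition_on_def disjoint_def)
  then have b: "b \<notin> C"
    using B by auto
  have strict: "Min C < a" "a < Max C"
    using C(2) mem by (auto simp: covers_def order_less_le)
  have cross: False if "X \<in> P" "Y \<in> P" "X \<noteq> Y" "x1 \<in> X" "x2 \<in> X" "y1 \<in> Y" "y2 \<in> Y"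
      "x1 < y1" "y1 < x2" "x2 < y2" for X Y x1 x2 y1 y2
  proof -
    have "\<exists>B\<in>P. \<exists>C\<in>P. B \<noteq> C \<and>
        (\<exists>b1\<in>B. \<exists>b2\<in>B. \<exists>c1\<in>C. \<exists>c2\<in>C. b1 < c1 \<and> c1 < b2 \<and> b2 < c2)"
      by (rule bexI[OF _ that(1)], rule bexI[OF _ that(2)], rule conjI[OF that(3)],
          rule bexI[OF _ that(4)], rule bexI[OF _ that(5)], rule bexI[OF _ that(6)],
          rule bexI[OF _ that(7)]) (intro conjI that(8,9,10))
    then show False
      using nc unfolding noncrossing_def by (rule notE[rotated])
  qed
  have "\<not> b < Min C"
    using cross[OF B(1) C(1) \<open>B \<noteq> C\<close> B(3,2) mem _ strict] by blast
  moreover have "\<not> Max C < b"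
    using cross[OF C(1) B(1) \<open>B \<noteq> C\<close>[symmetric] mem B(2,3) strict] by blast
  ultimately have "Min C \<le> b \<and> b \<le> Max C"
    by (intro conjI leI)
  with b show ?thesis
    unfolding covers_def by (rule conjI)
qed

lemma depth_eq:
  assumes "P \<in> NC n" "B \<in> P" "a \<in> B"
  shows "depth P B = card {C \<in> P. covers C a}"
proof -
  have same: "card {C \<in> P. covers C b} = card {C \<in> P. covers C a}" if "b \<in> B" for b
    using covers_block_mono[OF assms(1,2,3) that] covers_block_mono[OF assms(1,2) that assms(3)]
    by (intro arg_cong[where f = card] Collect_cong conj_cong refl iffI) simp_all
  show ?thesis
    unfolding depth_def
  proof (rule the_equality)
    show "\<forall>b\<in>B. card {C \<in> P. covers C b} = card {C \<in> P. covers C a}"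
      by (intro ballI same)
  next
    fix d assume "\<forall>b\<in>B. card {C \<in> P. covers C b} = d"
    from this assms(3) have "card {C \<in> P. covers C a} = d"
      by (rule bspec)
    then show "d = card {C \<in> P. covers C a}"
      by (rule sym)
  qed
qed

end

theory Submission imports Defs begin

text \<open>Write \<open>C k\<close> for \<open>cpoly l k\<close> and \<open>w n k\<close> for the integral of \<open>x ^ n * C k\<close>. The three-term recurrence gives
  \<open>w (n + 1) k = w n (k + 1) + a k * w n k + l * w n (k - 1)\<close> with \<open>a k = l\<close> except \<open>a 1 = l + 1\<close>, while
  orthogonality to \<open>C 0 = 1\<close> gives \<open>w 0 k = 0\<close> for \<open>k > 0\<close>. The same recurrence counts non-crossing
  partitions read from left to right, with weight \<open>l\<close> per block, when \<open>k\<close> blocks are still open: the last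
  point closes or opens a block (coming from \<open>k + 1\<close> or \<open>k - 1\<close>), is a singleton (weight \<open>l\<close>), or is an
  intermediate point of the innermost open block. The last option creates a block of size at least 3,
  which is outer only if no other block is open, that is, if \<open>k = 1\<close>.\<close>

subsection \<open>Partitions with open blocks\<close>

lemma noncrossingD:
  assumes "noncrossing P" "B \<in> P" "C \<in> P" "b1 \<in> B" "b2 \<in> B" "c1 \<in> C" "c2 \<in> C"
    "b1 < c1" "c1 < b2" "b2 < c2"
  shows "B = C"
  using assms unfolding noncrossing_def by blast

text \<open>Strict witnesses on both sides replace \<open>Min\<close> and \<open>Max\<close>, since
  they carry over directly when points are added to or removed from blocks. For partitions in
  \<open>NC n\<close> this agrees with \<open>covers\<close>.\<close>

definition nests :: "nat set \<Rightarrow> nat \<Rightarrow> bool" where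
  "nests C b \<longleftrightarrow> b \<notin> C \<and> (\<exists>c1\<in>C. \<exists>c2\<in>C. c1 < b \<and> b < c2)"

text \<open>No ground set and no depth occur here, so the condition also applies while closing
  points of open blocks are present; these count towards the size of a block.\<close>

definition admissible :: "nat set set \<Rightarrow> bool" where
  "admissible P \<longleftrightarrow> noncrossing P \<and>
     (\<forall>B\<in>P. 3 \<le> card B \<longrightarrow> (\<forall>C\<in>P. \<forall>b\<in>B. \<not> nests C b))"

text \<open>The points of \<open>Y\<close> stand for the future closing points of the blocks that are still open
  after the points \<open>1, \<dots>, n\<close> have been read.\<close>
definition open_parts :: "nat \<Rightarrow> nat set \<Rightarrow> nat set set set" where
  "open_parts n Y = {P. partition_on ({1..n} \<union> Y) P \<and> admissible P \<and>
     (\<forall>B\<in>P. \<forall>y\<in>B \<inter> Y. \<forall>z\<in>B \<inter> Y. y = z) \<and>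
     (\<forall>B\<in>P. B \<inter> Y \<noteq> {} \<longrightarrow> B \<inter> {1..n} \<noteq> {})}"

lemma noncrossing_subset: "noncrossing P \<Longrightarrow> Q \<subseteq> P \<Longrightarrow> noncrossing Q"
  unfolding noncrossing_def by blast

lemma admissible_subset: "admissible P \<Longrightarrow> Q \<subseteq> P \<Longrightarrow> admissible Q"
  unfolding admissible_def using noncrossing_subset by blast

lemma partition_on_eq_block:
  "partition_on A P \<Longrightarrow> B \<in> P \<Longrightarrow> C \<in> P \<Longrightarrow> a \<in> B \<Longrightarrow> a \<in> C \<Longrightarrow> B = C"
  by (auto simp: partition_on_def disjoint_def)

lemma partition_on_block_subset: "partition_on A P \<Longrightarrow> B \<in> P \<Longrightarrow> B \<subseteq> A"
  by (auto simp: partition_on_def)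

lemma partition_on_obtain:
  assumes "partition_on A P" "a \<in> A"
  obtains B where "B \<in> P" "a \<in> B"
  using assms by (auto simp: partition_on_def)

text \<open>No point of \<open>A\<close> lies between \<open>x\<close> and \<open>y\<close>, so the
  new block neither crosses another one nor nests any point; having at most two points, it may
  itself be nested. Singletons are the case \<open>x = y\<close>.\<close>

lemma admissible_insert:
  assumes P: "admissible P" and U: "\<Union>P \<subseteq> A" and xy: "x \<le> y" and disj: "{x, y} \<inter> A = {}"
    and gap: "\<And>z. z \<in> A \<Longrightarrow> z < x \<or> y < z"
  shows "admissible (insert {x, y} P)"
proof -
  have gapB: "z < x \<or> y < z" if "B \<in> P" "z \<in> B" for B z
    using gap U that by blast
  have nc: "noncrossing P" and adm: "\<And>B C b. B \<in> P \<Longrightarrow> 3 \<le> card B \<Longrightarrow> C \<in> P \<Longrightarrow> b \<in> B \<Longrightarrow> \<not> nests C b"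
    using P by (auto simp: admissible_def)
  have "noncrossing (insert {x, y} P)"
    unfolding noncrossing_def
  proof (intro notI, elim bexE conjE)
    fix B C b1 b2 c1 c2
    assume BC: "B \<in> insert {x, y} P" "C \<in> insert {x, y} P" "B \<noteq> C"
      and b: "b1 \<in> B" "b2 \<in> B" and c: "c1 \<in> C" "c2 \<in> C"
      and lt: "b1 < c1" "c1 < b2" "b2 < c2"
    consider "B = {x, y}" "C \<in> P" | "C = {x, y}" "B \<in> P" | "B \<in> P" "C \<in> P"
      using BC by blast
    then show False
    proof cases
      case 1
      then show ?thesis using b lt xy gapB[OF 1(2) c(1)] by auto
    next
      case 2
      then show ?thesis using c lt xy gapB[OF 2(2) b(2)] by auto
    next
      case 3
      then show ?thesis using noncrossingD[OF nc 3 b c lt] BC by blast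
    qed
  qed
  moreover have "\<not> nests C b" if "B \<in> insert {x, y} P" "3 \<le> card B" "C \<in> insert {x, y} P" "b \<in> B" for B C b
  proof -
    have "card {x, y} \<le> 2" by (simp add: card_insert_if)
    then have B: "B \<in> P" using that by auto
    show ?thesis
    proof (cases "C = {x, y}")
      case True
      then show ?thesis using gapB[OF B that(4)] xy by (auto simp: nests_def)
    next
      case False
      then show ?thesis using adm[OF B that(2) _ that(4)] that(3) by blast
    qed
  qed
  ultimately show ?thesis unfolding admissible_def by blast
qed

lemma finite_open_parts: "finite Y \<Longrightarrow> finite (open_parts n Y)"
  by (rule finite_subset[of _ "Pow (Pow ({1..n} \<union> Y))"]) (auto simp: open_parts_def partition_on_def)

lemma finite_open_part: "finite Y \<Longrightarrow> P \<in> open_parts n Y \<Longrightarrow> finite P"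
  by (auto simp: open_parts_def intro: finite_elements)

text \<open>A block with a closing point must also contain a point already read, so no block is open
  at the start. This is the initial value of the recurrence.\<close>

lemma open_parts_0:
  assumes "\<forall>y\<in>Y. 0 < y"
  shows "open_parts 0 Y = (if Y = {} then {{}} else {})"
proof (cases "Y = {}")
  case True
  then show ?thesis
    by (auto simp: open_parts_def partition_on_def admissible_def noncrossing_def)
next
  case False
  then show ?thesis
    by (auto simp: open_parts_def partition_on_def)
qed

subsection \<open>The role of the last point\<close>

text \<open>The four roles that the point \<open>Suc n\<close> can play: singleton, closing, opening or
  intermediate point of its block.\<close>

lemma open_parts_singleton:
  assumes Y: "finite Y" "\<forall>y\<in>Y. Suc n < y"
  shows "{P \<in> open_parts (Suc n) Y. {Suc n} \<in> P} = insert {Suc n} ` open_parts n Y"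
proof (intro equalityI subsetI)
  fix P assume "P \<in> {P \<in> open_parts (Suc n) Y. {Suc n} \<in> P}"
  then have P: "P \<in> open_parts (Suc n) Y" and x: "{Suc n} \<in> P" by auto
  have part: "partition_on ({1..Suc n} \<union> Y) P" and adm: "admissible P"
    and u: "\<forall>B\<in>P. \<forall>y\<in>B \<inter> Y. \<forall>z\<in>B \<inter> Y. y = z"
    and m: "\<forall>B\<in>P. B \<inter> Y \<noteq> {} \<longrightarrow> B \<inter> {1..Suc n} \<noteq> {}"
    using P by (auto simp: open_parts_def)
  let ?Q = "P - {{Suc n}}"
  have notin: "Suc n \<notin> B" if "B \<in> ?Q" for B
    using partition_on_eq_block[OF part _ x, of B "Suc n"] that by auto
  have "partition_on ({1..Suc n} \<union> Y - {Suc n}) ?Q"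
    using partition_on_insert[of "{Suc n}" ?Q "{1..Suc n} \<union> Y"] part x notin
    by (auto simp: disjnt_def insert_absorb)
  moreover have "{1..Suc n} \<union> Y - {Suc n} = {1..n} \<union> Y" using Y by auto
  moreover have "admissible ?Q" using adm by (rule admissible_subset) auto
  moreover have "B \<inter> {1..n} \<noteq> {}" if "B \<in> ?Q" "B \<inter> Y \<noteq> {}" for B
    using m that notin[OF that(1)] by (force simp: le_Suc_eq)
  ultimately have "?Q \<in> open_parts n Y"
    using u by (auto simp: open_parts_def)
  moreover have "P = insert {Suc n} ?Q" using x by auto
  ultimately show "P \<in> insert {Suc n} ` open_parts n Y" by blast
next
  fix P assume "P \<in> insert {Suc n} ` open_parts n Y"
  then obtain Q where Q: "Q \<in> open_parts n Y" and PQ: "P = insert {Suc n} Q" by auto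
  have part: "partition_on ({1..n} \<union> Y) Q" and adm: "admissible Q"
    and u: "\<forall>B\<in>Q. \<forall>y\<in>B \<inter> Y. \<forall>z\<in>B \<inter> Y. y = z"
    and m: "\<forall>B\<in>Q. B \<inter> Y \<noteq> {} \<longrightarrow> B \<inter> {1..n} \<noteq> {}"
    using Q by (auto simp: open_parts_def)
  have UQ: "\<Union>Q = {1..n} \<union> Y" using part by (auto simp: partition_on_def)
  have "admissible (insert {Suc n, Suc n} Q)"
    by (rule admissible_insert[OF adm, of "{1..n} \<union> Y"]) (use UQ Y in auto)
  moreover have "{1..Suc n} \<union> Y - {Suc n} = {1..n} \<union> Y" using Y by auto
  then have "partition_on ({1..Suc n} \<union> Y) P"
    unfolding PQ using part UQ Y by (subst partition_on_insert) (auto simp: disjnt_def)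
  moreover have "B \<inter> {1..Suc n} \<noteq> {}" if "B \<in> P" "B \<inter> Y \<noteq> {}" for B
    using m that PQ by fastforce
  moreover have "\<forall>B\<in>P. \<forall>y\<in>B \<inter> Y. \<forall>z\<in>B \<inter> Y. y = z"
    using u Y PQ by auto
  ultimately show "P \<in> {P \<in> open_parts (Suc n) Y. {Suc n} \<in> P}"
    using PQ by (simp add: open_parts_def)
qed

text \<open>The same partitions of the same ground set are read in two ways: if \<open>Suc n\<close>
  ends a block of at least two points, then, seen from \<open>n\<close>, it is the closing point of
  a block still open.\<close>

lemma open_parts_closing:
  assumes Y: "finite Y" "\<forall>y\<in>Y. Suc n < y"
  shows "{P \<in> open_parts (Suc n) Y. {Suc n} \<notin> P \<and> (\<forall>B\<in>P. Suc n \<in> B \<longrightarrow> B \<inter> Y = {})} =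
    open_parts n (insert (Suc n) Y)"
proof -
  have eq: "{1..Suc n} \<union> Y = {1..n} \<union> insert (Suc n) Y" by auto
  \<comment> \<open>By \<open>eq\<close> the ground sets agree, and admissibility does not depend on
    \<open>n\<close>, so only the conditions on closing points remain to be compared.\<close>
  have A: "(\<forall>B\<in>P. B \<inter> Y \<noteq> {} \<longrightarrow> B \<inter> {1..Suc n} \<noteq> {}) \<and> {Suc n} \<notin> P \<and>
       (\<forall>B\<in>P. Suc n \<in> B \<longrightarrow> B \<inter> Y = {}) \<and> (\<forall>B\<in>P. \<forall>y\<in>B \<inter> Y. \<forall>z\<in>B \<inter> Y. y = z) \<longleftrightarrow>
     (\<forall>B\<in>P. \<forall>y\<in>B \<inter> insert (Suc n) Y. \<forall>z\<in>B \<inter> insert (Suc n) Y. y = z) \<and>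
     (\<forall>B\<in>P. B \<inter> insert (Suc n) Y \<noteq> {} \<longrightarrow> B \<inter> {1..n} \<noteq> {})" (is "?L \<longleftrightarrow> ?R")
    if part: "partition_on ({1..Suc n} \<union> Y) P" for P
  proof
    assume L: ?L
    have "B \<inter> {1..n} \<noteq> {}" if B: "B \<in> P" "B \<inter> insert (Suc n) Y \<noteq> {}" for B
    proof (cases "Suc n \<in> B")
      case True
      then have "B \<inter> Y = {}" "B \<noteq> {Suc n}" using L B by auto
      then obtain b where "b \<in> B" "b \<noteq> Suc n" "b \<notin> Y" using True by blast
      moreover have "B \<subseteq> {1..Suc n} \<union> Y" using partition_on_block_subset[OF part B(1)] .
      ultimately have "b \<in> B \<inter> {1..n}" by (auto simp: le_Suc_eq)
      then show ?thesis by blast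
    next
      case False
      then have "B \<inter> {1..Suc n} \<noteq> {}" using L B by auto
      then show ?thesis using False by (auto simp: le_Suc_eq)
    qed
    moreover have "y = z" if "B \<in> P" "y \<in> B \<inter> insert (Suc n) Y" "z \<in> B \<inter> insert (Suc n) Y" for B y z
      using L that by blast
    ultimately show ?R by blast
  next
    assume R: ?R
    have "{Suc n} \<notin> P" using R by fastforce
    moreover have "B \<inter> Y = {}" if B: "B \<in> P" "Suc n \<in> B" for B
    proof (rule ccontr)
      assume "B \<inter> Y \<noteq> {}"
      then obtain y where "y \<in> B" "y \<in> Y" by blast
      then have "y = Suc n" using R B by blast
      then show False using Y \<open>y \<in> Y\<close> by auto
    qed
    moreover have "B \<inter> {1..Suc n} \<noteq> {}" if "B \<in> P" "B \<inter> Y \<noteq> {}" for B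
    proof -
      have "B \<inter> {1..n} \<noteq> {}" using R that by blast
      then show ?thesis by (auto intro: le_SucI)
    qed
    moreover have "\<forall>B\<in>P. \<forall>y\<in>B \<inter> Y. \<forall>z\<in>B \<inter> Y. y = z" using R by (meson IntD1 IntD2 IntI insertI2)
    ultimately show ?L by simp
  qed
  show ?thesis
  proof (rule set_eqI)
    show "P \<in> {P \<in> open_parts (Suc n) Y. {Suc n} \<notin> P \<and> (\<forall>B\<in>P. Suc n \<in> B \<longrightarrow> B \<inter> Y = {})} \<longleftrightarrow>
        P \<in> open_parts n (insert (Suc n) Y)" for P
      using A[of P] unfolding open_parts_def eq[symmetric] mem_Collect_eq by argo
  qed
qed

text \<open>By non-crossing, open blocks close in the reverse order of their opening, so a block
  opened at the last point must close first, at \<open>Min Y\<close>. Deleting this pair leaves one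
  open block fewer.\<close>

lemma open_parts_opening:
  assumes Y: "finite Y" "\<forall>y\<in>Y. Suc n < y" and ne: "Y \<noteq> {}"
  shows "{P \<in> open_parts (Suc n) Y. \<exists>y\<in>Y. {Suc n, y} \<in> P} =
    insert {Suc n, Min Y} ` open_parts n (Y - {Min Y})"
proof (intro equalityI subsetI)
  let ?y = "Min Y"
  have yY: "?y \<in> Y" and ymin: "\<And>z. z \<in> Y \<Longrightarrow> ?y \<le> z" using Y ne by auto
  fix P assume "P \<in> {P \<in> open_parts (Suc n) Y. \<exists>y\<in>Y. {Suc n, y} \<in> P}"
  then obtain y where P: "P \<in> open_parts (Suc n) Y" and y: "y \<in> Y" and x': "{Suc n, y} \<in> P" by auto
  have part: "partition_on ({1..Suc n} \<union> Y) P" and adm: "admissible P"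
    and u: "\<forall>B\<in>P. \<forall>y\<in>B \<inter> Y. \<forall>z\<in>B \<inter> Y. y = z"
    and m: "\<forall>B\<in>P. B \<inter> Y \<noteq> {} \<longrightarrow> B \<inter> {1..Suc n} \<noteq> {}"
    using P by (auto simp: open_parts_def)
  have nc: "noncrossing P" using adm by (simp add: admissible_def)
  \<comment> \<open>Otherwise the block \<open>C\<close> of \<open>?y\<close> has a point
    \<open>c\<close> already read, and \<open>c < Suc n < ?y < y\<close> is a crossing of
    \<open>C\<close> with \<open>{Suc n, y}\<close>.\<close>
  have "y = ?y"
  proof (rule ccontr)
    assume neq: "y \<noteq> ?y"
    obtain C where C: "C \<in> P" "?y \<in> C" using partition_on_obtain[OF part] yY by blast
    then obtain c where c: "c \<in> C" "c \<in> {1..Suc n}" using m yY by blast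
    have "Suc n \<notin> C"
    proof
      assume "Suc n \<in> C"
      then have "C = {Suc n, y}"
        using partition_on_eq_block[OF part C(1) x', of "Suc n"] by simp
      then show False using C yY Y neq by auto
    qed
    then have "c < Suc n" using c by (auto simp: order_le_less)
    then have "C = {Suc n, y}"
      using noncrossingD[OF nc C(1) x' c(1) C(2), of "Suc n" y] ymin[OF y] neq Y yY by auto
    then show False using \<open>Suc n \<notin> C\<close> by blast
  qed
  then have x: "{Suc n, ?y} \<in> P" using x' by simp
  let ?Q = "P - {{Suc n, ?y}}"
  have notin: "Suc n \<notin> B" "?y \<notin> B" if "B \<in> ?Q" for B
    using partition_on_eq_block[OF part _ x, of B "Suc n"]
      partition_on_eq_block[OF part _ x, of B ?y] that by auto
  have "partition_on ({1..Suc n} \<union> Y - {Suc n, ?y}) ?Q"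
    using partition_on_insert[of "{Suc n, ?y}" ?Q "{1..Suc n} \<union> Y"] part x notin
    by (auto simp: disjnt_def insert_absorb)
  moreover have "{1..Suc n} \<union> Y - {Suc n, ?y} = {1..n} \<union> (Y - {?y})" using Y yY by force
  moreover have "admissible ?Q" using adm by (rule admissible_subset) auto
  moreover have "B \<inter> {1..n} \<noteq> {}" if "B \<in> ?Q" "B \<inter> (Y - {?y}) \<noteq> {}" for B
    using m that notin[OF that(1)] by (force simp: le_Suc_eq)
  ultimately have "?Q \<in> open_parts n (Y - {?y})"
    using u by (auto simp: open_parts_def)
  moreover have "P = insert {Suc n, ?y} ?Q" using x by auto
  ultimately show "P \<in> insert {Suc n, ?y} ` open_parts n (Y - {?y})" by blast
next
  let ?y = "Min Y"
  have yY: "?y \<in> Y" and ymin: "\<And>z. z \<in> Y \<Longrightarrow> ?y \<le> z" using Y ne by auto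
  fix P assume "P \<in> insert {Suc n, ?y} ` open_parts n (Y - {?y})"
  then obtain Q where Q: "Q \<in> open_parts n (Y - {?y})" and PQ: "P = insert {Suc n, ?y} Q" by auto
  have part: "partition_on ({1..n} \<union> (Y - {?y})) Q" and adm: "admissible Q"
    and u: "\<forall>B\<in>Q. \<forall>y\<in>B \<inter> (Y - {?y}). \<forall>z\<in>B \<inter> (Y - {?y}). y = z"
    and m: "\<forall>B\<in>Q. B \<inter> (Y - {?y}) \<noteq> {} \<longrightarrow> B \<inter> {1..n} \<noteq> {}"
    using Q by (auto simp: open_parts_def)
  have yn: "Suc n < ?y" using Y yY by auto
  have UQ: "\<Union>Q = {1..n} \<union> (Y - {?y})" using part by (auto simp: partition_on_def)
  have notin: "?y \<notin> B" "Suc n \<notin> B" if "B \<in> Q" for B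
  proof -
    have "B \<subseteq> {1..n} \<union> (Y - {?y})" using UQ that by blast
    then show "?y \<notin> B" "Suc n \<notin> B" using yn Y by auto
  qed
  have "admissible P" unfolding PQ
  proof (rule admissible_insert[OF adm, of "{1..n} \<union> (Y - {?y})"])
    fix z assume "z \<in> {1..n} \<union> (Y - {?y})"
    then show "z < Suc n \<or> ?y < z" using ymin[of z] by auto
  qed (use UQ Y yn in auto)
  moreover have "{1..Suc n} \<union> Y - {Suc n, ?y} = {1..n} \<union> (Y - {?y})" using Y yn by force
  then have "partition_on ({1..Suc n} \<union> Y) P"
    unfolding PQ using part notin yY by (subst partition_on_insert) (auto simp: disjnt_def)
  moreover have "B \<inter> {1..Suc n} \<noteq> {}" if "B \<in> P" "B \<inter> Y \<noteq> {}" for B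
  proof (cases "B \<in> Q")
    case True
    then have "B \<inter> {1..n} \<noteq> {}" using m that notin by blast
    then show ?thesis by (auto intro: le_SucI)
  next
    case False
    then show ?thesis using that PQ by auto
  qed
  moreover have "y = z" if B: "B \<in> P" "y \<in> B \<inter> Y" "z \<in> B \<inter> Y" for B y z
  proof (cases "B \<in> Q")
    case True
    then have "y \<in> B \<inter> (Y - {?y})" "z \<in> B \<inter> (Y - {?y})" using B notin by auto
    then show ?thesis using u True by blast
  next
    case False
    then show ?thesis using B PQ Y by auto
  qed
  ultimately show "P \<in> {P \<in> open_parts (Suc n) Y. \<exists>y\<in>Y. {Suc n, y} \<in> P}"
    using PQ yY by (auto simp: open_parts_def)
qed

section \<open>Intermediate points: removing a point from its block and adjoining it again\<close>

lemma admissible_Diff: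
  assumes part: "partition_on A P" and A: "finite A" and adm: "admissible P"
  shows "admissible ((\<lambda>B. B - X) ` P)"
  unfolding admissible_def
proof (intro conjI ballI impI notI)
  have nc: "noncrossing P" using adm by (simp add: admissible_def)
  show "noncrossing ((\<lambda>B. B - X) ` P)"
    unfolding noncrossing_def
  proof (intro notI, elim bexE conjE imageE)
    fix B C B' C' b1 b2 c1 c2
    assume "B \<noteq> C" "B' \<in> P" "C' \<in> P" "B = B' - X" "C = C' - X" "b1 \<in> B" "b2 \<in> B" "c1 \<in> C" "c2 \<in> C"
      "b1 < c1" "c1 < b2" "b2 < c2"
    then show False using noncrossingD[OF nc, of B' C' b1 b2 c1 c2] by auto
  qed
next
  fix B C b
  assume B: "B \<in> (\<lambda>B. B - X) ` P" "3 \<le> card B" "b \<in> B" and C: "C \<in> (\<lambda>B. B - X) ` P" "nests C b"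
  obtain B' C' where B': "B' \<in> P" "B = B' - X" and C': "C' \<in> P" "C = C' - X" using B C by auto
  have "B' \<subseteq> A" by (rule partition_on_block_subset[OF part B'(1)])
  then have "card B \<le> card B'" using A B' by (intro card_mono) (auto intro: finite_subset)
  \<comment> \<open>As \<open>B'\<close> is at least as large as \<open>B\<close>, it is not nested
    by \<open>C'\<close>. The witnesses around \<open>b\<close> survive in \<open>C'\<close>, so
    \<open>b\<close> itself must lie in \<open>C'\<close>; then \<open>B' = C'\<close>, hence
    \<open>B = C\<close>, contrary to nesting.\<close>
  then have "\<not> nests C' b" using adm B B' C' by (auto simp: admissible_def)
  then have "b \<in> C'" using C(2) C' by (auto simp: nests_def)
  then have "B' = C'" using partition_on_eq_block[OF part B'(1) C'(1), of b] B(3) B' by auto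
  then show False using C(2) B(3) B' C' by (auto simp: nests_def)
qed

text \<open>An image over all blocks, so that removing \<open>x\<close> from every block undoes it
  whenever \<open>x\<close> is a new point; injectivity is then immediate.\<close>

definition adjoin :: "'a \<Rightarrow> 'a \<Rightarrow> 'a set set \<Rightarrow> 'a set set" where
  "adjoin x y P = (\<lambda>B. if y \<in> B then insert x B else B) ` P"

lemma remove_adjoin:
  assumes "x \<notin> \<Union>P"
  shows "(\<lambda>B. B - {x}) ` adjoin x y P = P"
proof -
  have "(if y \<in> B then insert x B else B) - {x} = B" if "B \<in> P" for B
    using assms that by auto
  then show ?thesis by (simp only: adjoin_def image_image cong: image_cong) simp
qed

lemma card_adjoin:
  assumes "x \<notin> \<Union>P"
  shows "card (adjoin x y P) = card P"
  unfolding adjoin_def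
proof (rule card_image, rule inj_on_inverseI)
  show "(if y \<in> B then insert x B else B) - {x} = B" if "B \<in> P" for B
    using assms that by auto
qed

text \<open>Since \<open>y\<close> is the only closing point, all blocks but its own end before
  \<open>Suc n\<close>. Wherever \<open>Suc n\<close> could take part in a crossing or nesting,
  \<open>y\<close> already does so in \<open>Q\<close>.\<close>

lemma adjoin_in_open_parts:
  assumes y: "Suc n < y" and Q: "Q \<in> open_parts n {y}"
  shows "adjoin (Suc n) y Q \<in> {P \<in> open_parts (Suc n) {y}.
    \<exists>B\<in>P. Suc n \<in> B \<and> B \<inter> {y} \<noteq> {} \<and> B \<inter> {1..n} \<noteq> {}}"
proof -
  let ?x = "Suc n"
  have part: "partition_on ({1..n} \<union> {y}) Q" and adm: "admissible Q"
    and m: "\<And>B. B \<in> Q \<Longrightarrow> y \<in> B \<Longrightarrow> B \<inter> {1..n} \<noteq> {}"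
    using Q by (auto simp: open_parts_def)
  have nc: "noncrossing Q" using adm by (simp add: admissible_def)
  obtain B0 where B0: "B0 \<in> Q" "y \<in> B0" using partition_on_obtain[OF part] by blast
  have sub: "B \<subseteq> {1..n} \<union> {y}" if "B \<in> Q" for B
    using partition_on_block_subset[OF part that] .
  have y0: "y \<notin> B" if "B \<in> Q" "B \<noteq> B0" for B
    using partition_on_eq_block[OF part that(1) B0(1)] B0(2) that by blast
  have other: "B \<subseteq> {1..n}" if "B \<in> Q" "B \<noteq> B0" for B
    using sub[OF that(1)] y0[OF that] by blast
  have P: "adjoin ?x y Q = insert (insert ?x B0) (Q - {B0})" (is "_ = ?P")
    using B0 y0 unfolding adjoin_def by (auto simp: image_iff)
  have disj: "disjnt B0 (\<Union>(Q - {B0}))"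
    using partition_on_eq_block[OF part B0(1)] by (auto simp: disjnt_def)
  have "partition_on ({1..n} \<union> {y} - B0) (Q - {B0})"
    using part disj B0 partition_on_insert[of B0 "Q - {B0}"] by (auto simp: insert_absorb)
  moreover have "{1..Suc n} \<union> {y} - insert ?x B0 = {1..n} \<union> {y} - B0" using y by auto
  moreover have "insert ?x B0 \<subseteq> {1..Suc n} \<union> {y}" using sub[OF B0(1)] by auto
  moreover have disj': "disjnt (insert ?x B0) (\<Union>(Q - {B0}))"
    using disj other by (force simp: disjnt_def)
  ultimately have part': "partition_on ({1..Suc n} \<union> {y}) ?P"
    unfolding partition_on_insert[OF disj'] by simp
  have nc': "noncrossing ?P"
    unfolding noncrossing_def
  proof (intro notI, elim bexE conjE)
    fix B C b1 b2 c1 c2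
    assume BC: "B \<in> ?P" "C \<in> ?P" "B \<noteq> C"
      and b: "b1 \<in> B" "b2 \<in> B" and c: "c1 \<in> C" "c2 \<in> C"
      and lt: "b1 < c1" "c1 < b2" "b2 < c2"
    consider "B = insert ?x B0" "C \<in> Q" "C \<noteq> B0" | "C = insert ?x B0" "B \<in> Q" "B \<noteq> B0"
      | "B \<in> Q" "C \<in> Q"
      using BC by blast
    then show False
    proof cases
      case 1
      then have "c2 \<le> n" using other c by fastforce
      then have "b1 \<in> B0" "b2 \<in> B0" using 1 b lt by auto
      then show ?thesis using noncrossingD[OF nc B0(1) 1(2) _ _ c lt] 1 by blast
    next
      \<comment> \<open>The right end \<open>c2\<close> may be the new point; \<open>y\<close>
        replaces it.\<close>
      case 2
      then have "b2 \<le> n" using other b by fastforce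
      then have "c1 \<in> B0" "b2 < y" using 2 c lt y by auto
      then show ?thesis using noncrossingD[OF nc 2(2) B0(1) b _ B0(2) lt(1,2)] 2 by blast
    next
      case 3
      then show ?thesis using noncrossingD[OF nc 3 b c lt] BC by blast
    qed
  qed
  have adm': "\<not> nests C b" if B: "B \<in> ?P" "3 \<le> card B" and C: "C \<in> ?P" and b: "b \<in> B" for B C b
  proof
    assume "nests C b"
    then obtain c1 c2 where c: "c1 \<in> C" "c2 \<in> C" "c1 < b" "b < c2" and bC: "b \<notin> C"
      by (auto simp: nests_def)
    have neq: "B \<noteq> C" using b bC by blast
    consider "B = insert ?x B0" "C \<in> Q" "C \<noteq> B0" | "C = insert ?x B0" "B \<in> Q" "B \<noteq> B0"
      | "B \<in> Q" "C \<in> Q"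
      using B C neq by blast
    then show False
    proof cases
      \<comment> \<open>The block may have reached size 3 only through \<open>Suc n\<close>, so
        admissibility of \<open>Q\<close> gives nothing here. Instead, a block \<open>C\<close>
        nesting \<open>b\<close> would cross \<open>B0\<close>, which also contains \<open>y\<close>
        beyond \<open>c2\<close>.\<close>
      case 1
      then have "c2 \<le> n" using other c by fastforce
      then have "b \<in> B0" "c2 < y" using 1 b c y by auto
      then show ?thesis using noncrossingD[OF nc 1(2) B0(1) c(1,2) _ B0(2) c(3,4)] 1 by blast
    next
      case 2
      then have "b \<le> n" using other b by fastforce
      then have "b < y" "c1 \<in> B0" "b \<notin> B0" using 2 c y bC by auto
      then have "nests B0 b" using c(3) B0(2) unfolding nests_def by blast
      then show ?thesis using adm 2 B B0(1) b by (auto simp: admissible_def)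
    next
      case 3
      then show ?thesis using adm B b \<open>nests C b\<close> by (auto simp: admissible_def)
    qed
  qed
  have "admissible ?P" unfolding admissible_def using nc' adm' by blast
  moreover have "\<forall>B\<in>?P. B \<inter> {y} \<noteq> {} \<longrightarrow> B \<inter> {1..Suc n} \<noteq> {}"
  proof (intro ballI impI)
    fix B assume "B \<in> ?P" "B \<inter> {y} \<noteq> {}"
    then have "B = insert ?x B0" using y0[of B] by fast
    then show "B \<inter> {1..Suc n} \<noteq> {}" by simp
  qed
  moreover have "\<forall>B\<in>?P. \<forall>a\<in>B \<inter> {y}. \<forall>b\<in>B \<inter> {y}. a = b" by simp
  ultimately have "?P \<in> open_parts (Suc n) {y}"
    using part' by (simp only: open_parts_def mem_Collect_eq simp_thms)
  moreover have "insert ?x B0 \<inter> {1..n} \<noteq> {}" using m[OF B0] by auto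
  moreover have "\<exists>B\<in>?P. ?x \<in> B \<and> B \<inter> {y} \<noteq> {} \<and> B \<inter> {1..n} \<noteq> {}"
    using B0(2) \<open>insert ?x B0 \<inter> {1..n} \<noteq> {}\<close> by (intro bexI[of _ "insert ?x B0"]) auto
  ultimately show ?thesis unfolding P by simp
qed

text \<open>Removing \<open>Suc n\<close> from its block inverts \<open>adjoin\<close>. The block
  stays open, since it keeps \<open>y\<close> and a point of \<open>{1..n}\<close>.\<close>

lemma open_parts_intermediate:
  assumes y: "Suc n < y"
  shows "{P \<in> open_parts (Suc n) {y}. \<exists>B\<in>P. Suc n \<in> B \<and> B \<inter> {y} \<noteq> {} \<and> B \<inter> {1..n} \<noteq> {}} =
    adjoin (Suc n) y ` open_parts n {y}" (is "?S = _")
proof (intro equalityI subsetI)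
  let ?x = "Suc n"
  fix P assume "P \<in> ?S"
  then obtain B1 where P: "P \<in> open_parts (Suc n) {y}"
    and B1: "B1 \<in> P" "Suc n \<in> B1" "y \<in> B1" "B1 \<inter> {1..n} \<noteq> {}" by auto
  have part: "partition_on ({1..Suc n} \<union> {y}) P" and adm: "admissible P"
    using P by (auto simp: open_parts_def)
  have x0: "Suc n \<notin> B" "y \<notin> B" if "B \<in> P" "B \<noteq> B1" for B
    using partition_on_eq_block[OF part that(1) B1(1)] B1 that by blast+
  define Q where "Q = (\<lambda>B. B - {Suc n}) ` P"
  have "(\<lambda>B. B - {Suc n}) ` (P - {B1}) = (\<lambda>B. B) ` (P - {B1})"
    by (rule image_cong) (use x0 in auto)
  then have Q: "Q = insert (B1 - {Suc n}) (P - {B1})"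
    using image_insert[of "\<lambda>B. B - {Suc n}" B1 "P - {B1}"] B1(1)
    by (simp add: Q_def insert_absorb)
  have "admissible Q"
    unfolding Q_def by (rule admissible_Diff[OF part _ adm]) simp
  moreover have "partition_on ({1..n} \<union> {y}) Q"
  proof -
    have disj: "disjnt B1 (\<Union>(P - {B1}))"
      using partition_on_eq_block[OF part B1(1)] by (auto simp: disjnt_def)
    have "partition_on ({1..Suc n} \<union> {y} - B1) (P - {B1})"
      using part disj B1 partition_on_insert[of B1 "P - {B1}"] by (auto simp: insert_absorb)
    moreover have "{1..Suc n} \<union> {y} - B1 = {1..n} \<union> {y} - (B1 - {Suc n})"
      using B1 y by (auto simp: le_Suc_eq)
    moreover have "disjnt (B1 - {Suc n}) (\<Union>(P - {B1}))"
      using disj by (auto simp: disjnt_def)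
    moreover have "B1 - {Suc n} \<subseteq> {1..n} \<union> {y}"
      using partition_on_block_subset[OF part B1(1)] by (auto simp: le_Suc_eq)
    moreover have "B1 - {Suc n} \<noteq> {}" using B1 by auto
    ultimately show ?thesis unfolding Q by (subst partition_on_insert) auto
  qed
  moreover have "B \<inter> {1..n} \<noteq> {}" if "B \<in> Q" "y \<in> B" for B
    using that x0 B1(4) unfolding Q by fastforce
  ultimately have "Q \<in> open_parts n {y}" by (auto simp: open_parts_def)
  moreover have "adjoin ?x y Q = P"
  proof -
    have "(if y \<in> B - {?x} then insert ?x (B - {?x}) else B - {?x}) = B" if "B \<in> P" for B
      using x0[OF that] B1 y by (cases "B = B1") auto
    then show ?thesis by (simp only: adjoin_def Q_def image_image cong: image_cong) simp
  qed
  ultimately show "P \<in> adjoin ?x y ` open_parts n {y}" by blast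
qed (use adjoin_in_open_parts[OF y] in blast)

text \<open>The block contains \<open>b\<close>, \<open>Suc n\<close> and \<open>y\<close>, so its
  size is at least 3 and it must not be nested. A second open block would reach from before
  \<open>Suc n\<close> to its closing point and nest \<open>Suc n\<close>. Hence the exceptional
  coefficient at \<open>k = 1\<close>.\<close>

lemma open_parts_intermediate_card:
  assumes Y: "finite Y" "\<forall>y\<in>Y. Suc n < y" and P: "P \<in> open_parts (Suc n) Y"
    and B: "B \<in> P" "Suc n \<in> B" "y \<in> B" "y \<in> Y" "b \<in> B" "b \<in> {1..n}"
  shows "Y = {y}"
proof -
  have part: "partition_on ({1..Suc n} \<union> Y) P" and adm: "admissible P"
    and u: "\<forall>B\<in>P. \<forall>y\<in>B \<inter> Y. \<forall>z\<in>B \<inter> Y. y = z"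
    and m: "\<forall>B\<in>P. B \<inter> Y \<noteq> {} \<longrightarrow> B \<inter> {1..Suc n} \<noteq> {}"
    using P by (auto simp: open_parts_def)
  have "B \<subseteq> {1..Suc n} \<union> Y" by (rule partition_on_block_subset[OF part B(1)])
  then have "finite B" by (rule finite_subset) (use Y in simp)
  then have "card {b, Suc n, y} \<le> card B" using B by (intro card_mono) auto
  moreover have "Suc n < y" using Y B by blast
  ultimately have big: "3 \<le> card B" using B by (simp add: card_insert_if)
  have "z = y" if z: "z \<in> Y" for z
  proof (rule ccontr)
    assume neq: "z \<noteq> y"
    obtain C where C: "C \<in> P" "z \<in> C" using partition_on_obtain[OF part] z by blast
    have "C \<noteq> B" using u B C z neq by blast
    then have notin: "Suc n \<notin> C" using partition_on_eq_block[OF part B(1) C(1)] B by blast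
    obtain c where c: "c \<in> C" "c \<in> {1..Suc n}" using m C z by blast
    then have "c < Suc n" using notin by (auto simp: order_le_less)
    moreover have "Suc n < z" using Y z by blast
    ultimately have "nests C (Suc n)" using c C notin by (auto simp: nests_def)
    then show False using adm big B C by (auto simp: admissible_def)
  qed
  then show ?thesis using B by blast
qed

subsection \<open>The recurrence for the weighted count\<close>

lemma inj_on_insert_avoiding: "(\<And>P. P \<in> S \<Longrightarrow> B \<notin> P) \<Longrightarrow> inj_on (insert B) S"
  by (rule inj_on_inverseI[where g = "\<lambda>P. P - {B}"]) auto

lemma open_parts_Union: "P \<in> open_parts n Y \<Longrightarrow> \<Union>P = {1..n} \<union> Y"
  by (auto simp: open_parts_def partition_on_def)

lemma sum_insert_block:
  fixes l :: real
  assumes "finite Y" "\<And>P. P \<in> open_parts n Y \<Longrightarrow> B \<notin> P"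
  shows "(\<Sum>P\<in>insert B ` open_parts n Y. l ^ card P) = l * (\<Sum>P\<in>open_parts n Y. l ^ card P)"
proof -
  have "(\<Sum>P\<in>insert B ` open_parts n Y. l ^ card P) = (\<Sum>P\<in>open_parts n Y. l ^ card (insert B P))"
    by (subst sum.reindex[OF inj_on_insert_avoiding]) (use assms(2) in auto)
  also have "\<dots> = (\<Sum>P\<in>open_parts n Y. l * l ^ card P)"
    using assms finite_open_part by (intro sum.cong) (auto simp: card_insert_if)
  finally show ?thesis by (simp add: sum_distrib_left)
qed

text \<open>The summands belong to the roles singleton, closing, opening and intermediate point. The
  factor \<open>l\<close> appears exactly where taking away the last point takes away a whole block;
  an intermediate point occurs only when exactly one block is open.\<close>

lemma sum_open_parts_Suc:
  fixes l :: real
  assumes Y: "finite Y" "\<forall>y\<in>Y. Suc n < y"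
  shows "(\<Sum>P\<in>open_parts (Suc n) Y. l ^ card P) =
    l * (\<Sum>P\<in>open_parts n Y. l ^ card P) +
    (\<Sum>P\<in>open_parts n (insert (Suc n) Y). l ^ card P) +
    (if Y = {} then 0 else l * (\<Sum>P\<in>open_parts n (Y - {Min Y}). l ^ card P)) +
    (if card Y = 1 then (\<Sum>P\<in>open_parts n Y. l ^ card P) else 0)"
proof -
  let ?x = "Suc n" and ?S = "open_parts (Suc n) Y" and ?w = "\<lambda>P :: nat set set. l ^ card P"
  define T1 where "T1 = {P \<in> ?S. {?x} \<in> P}"
  define T2 where "T2 = {P \<in> ?S. {?x} \<notin> P \<and> (\<forall>B\<in>P. ?x \<in> B \<longrightarrow> B \<inter> Y = {})}"
  define T3 where "T3 = {P \<in> ?S. \<exists>y\<in>Y. {?x, y} \<in> P}"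
  define T4 where "T4 = {P \<in> ?S. \<exists>B\<in>P. ?x \<in> B \<and> B \<inter> Y \<noteq> {} \<and> B \<inter> {1..n} \<noteq> {}}"
  note T = T1_def T2_def T3_def T4_def
  have part: "partition_on ({1..Suc n} \<union> Y) P" if "P \<in> ?S" for P
    using that by (simp add: open_parts_def)
  have eqB: "B = C" if "P \<in> ?S" "B \<in> P" "C \<in> P" "?x \<in> B" "?x \<in> C" for P B C
    using partition_on_eq_block[OF part[OF that(1)] that(2-)] .
  \<comment> \<open>Let \<open>B\<close> be the block of \<open>Suc n\<close>. If it avoids
    \<open>Y\<close>, the point is a singleton or closes; if it meets \<open>Y\<close>, the point
    opens or is intermediate, according to whether \<open>B\<close> avoids or meets
    \<open>{1..n}\<close>.\<close>
  have "P \<in> T1 \<union> T2 \<union> T3 \<union> T4" if P: "P \<in> ?S" for P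
  proof -
    obtain B where B: "B \<in> P" "?x \<in> B" using partition_on_obtain[OF part[OF P], of ?x] by auto
    have uniq: "C = B" if "C \<in> P" "?x \<in> C" for C using eqB[OF P that(1) B(1) that(2) B(2)] .
    have sub: "B \<subseteq> {1..Suc n} \<union> Y" by (rule partition_on_block_subset[OF part[OF P] B(1)])
    show ?thesis
    proof (cases "B \<inter> Y = {}")
      case True
      then have "P \<in> T1 \<union> T2" using uniq P unfolding T by blast
      then show ?thesis by blast
    next
      case False
      then obtain y where y: "y \<in> B" "y \<in> Y" by blast
      show ?thesis
      proof (cases "B \<inter> {1..n} = {}")
        case True
        have "z = y" if "z \<in> B" "z \<in> Y" for z
          using P B y that unfolding open_parts_def by blast
        moreover have "z = ?x \<or> z \<in> Y" if "z \<in> B" for z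
        proof -
          have "z \<in> {1..Suc n} \<union> Y" "z \<notin> {1..n}" using that sub True by blast+
          then show ?thesis by (auto simp: le_Suc_eq)
        qed
        ultimately have "B = {?x, y}" using B y by blast
        then have "P \<in> T3" using P B y unfolding T by blast
        then show ?thesis by blast
      next
        case False
        then have "P \<in> T4" using P B y unfolding T by blast
        then show ?thesis by blast
      qed
    qed
  qed
  then have "?S \<subseteq> T1 \<union> T2 \<union> T3 \<union> T4" by (rule subsetI)
  moreover have "T1 \<union> T2 \<union> T3 \<union> T4 \<subseteq> ?S"
    unfolding T by (intro Un_least Collect_restrict)
  ultimately have S: "?S = T1 \<union> T2 \<union> T3 \<union> T4" by (rule equalityI)
  have xY: "?x \<notin> Y" and nY: "Y \<inter> {1..n} = {}" using Y by auto
  \<comment> \<open>The block of \<open>Suc n\<close> is unique and each role prescribes a different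
    shape for it, so the four classes are disjoint.\<close>
  have d1: "T1 \<inter> T2 = {}" unfolding T by blast
  have d2: "(T1 \<union> T2) \<inter> T3 = {}"
  proof -
    have False if T12: "P \<in> T1 \<or> P \<in> T2" and T3: "P \<in> T3" for P
    proof -
      obtain y where P: "P \<in> ?S" "{?x, y} \<in> P" "y \<in> Y" using T3 unfolding T3_def by blast
      have "{?x} \<in> P"
        using T12
      proof
        assume "P \<in> T2"
        then have "\<forall>B\<in>P. ?x \<in> B \<longrightarrow> B \<inter> Y = {}" by (simp add: T2_def)
        from this[rule_format, OF P(2)] show ?thesis using P(3) by simp
      qed (simp add: T1_def)
      then have "{?x, y} = {?x}" by (intro eqB[OF P(1,2)]) simp_all
      then show False using xY P(3) by blast
    qed
    then show ?thesis by blast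
  qed
  have d3: "(T1 \<union> T2 \<union> T3) \<inter> T4 = {}"
  proof -
    have False if P: "P \<in> ?S" and B: "B \<in> P" "?x \<in> B" "B \<inter> Y \<noteq> {}" "B \<inter> {1..n} \<noteq> {}"
      and cases: "P \<in> T1 \<or> P \<in> T2 \<or> P \<in> T3" for P B
      using cases
    proof (elim disjE)
      assume "P \<in> T1"
      then have "{?x} = B" by (intro eqB[OF P _ B(1) _ B(2)]) (simp_all add: T1_def)
      then show False using B(3) xY by auto
    next
      assume "P \<in> T2"
      then show False using B(1-3) by (simp add: T2_def)
    next
      assume "P \<in> T3"
      then obtain y where "y \<in> Y" "{?x, y} \<in> P" unfolding T3_def by blast
      then have "B = {?x, y}" by (intro eqB[OF P B(1) _ B(2)]) simp_all
      then show False using B(4) nY \<open>y \<in> Y\<close> by auto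
    qed
    then show ?thesis unfolding T4_def by blast
  qed
  have fin: "finite T1" "finite T2" "finite T3" "finite T4"
    using finite_open_parts[OF Y(1), of "Suc n"] unfolding T by auto
  have "sum ?w ?S = sum ?w T1 + sum ?w T2 + sum ?w T3 + sum ?w T4"
    unfolding S using fin d1 d2 d3 by (simp add: sum.union_disjoint)
  moreover have "sum ?w T1 = l * sum ?w (open_parts n Y)"
    unfolding T1_def open_parts_singleton[OF Y]
  proof (rule sum_insert_block[OF Y(1)])
    show "{?x} \<notin> P" if "P \<in> open_parts n Y" for P
      proof -
        have "?x \<notin> \<Union>P" using open_parts_Union[OF that] xY by simp
        then show ?thesis by blast
      qed
  qed
  moreover have "sum ?w T2 = sum ?w (open_parts n (insert ?x Y))"
    unfolding T2_def open_parts_closing[OF Y] ..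
  moreover have "sum ?w T3 = (if Y = {} then 0 else l * sum ?w (open_parts n (Y - {Min Y})))"
  proof (cases "Y = {}")
    case True
    then show ?thesis by (simp add: T3_def)
  next
    case False
    have "sum ?w T3 = l * sum ?w (open_parts n (Y - {Min Y}))"
      unfolding T3_def open_parts_opening[OF Y False]
    proof (rule sum_insert_block)
      show "{?x, Min Y} \<notin> P" if "P \<in> open_parts n (Y - {Min Y})" for P
        proof -
        have "?x \<notin> \<Union>P" using open_parts_Union[OF that] xY by simp
        then show ?thesis by blast
      qed
    qed (use Y in simp)
    then show ?thesis using False by simp
  qed
  moreover have "sum ?w T4 = (if card Y = 1 then sum ?w (open_parts n Y) else 0)"
  proof (cases "card Y = 1")
    case True
    then obtain y where y: "Y = {y}" by (rule card_1_singletonE)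
    then have lt: "Suc n < y" using Y by simp
    have x: "?x \<notin> \<Union>P" if "P \<in> open_parts n {y}" for P
      using open_parts_Union[OF that] lt by auto
    have inj: "inj_on (adjoin ?x y) (open_parts n {y})"
      using remove_adjoin[OF x] by (rule inj_on_inverseI)
    have "sum ?w T4 = (\<Sum>P\<in>open_parts n {y}. l ^ card (adjoin ?x y P))"
      unfolding T4_def y open_parts_intermediate[OF lt] using inj by (subst sum.reindex) auto
    also have "\<dots> = sum ?w (open_parts n {y})"
      using card_adjoin[OF x] by (intro sum.cong) auto
    finally show ?thesis using True y by simp
  next
    case False
    have "T4 = {}"
    proof (rule equals0I)
      fix P assume "P \<in> T4"
      then obtain B b y where P: "P \<in> ?S" "B \<in> P" "?x \<in> B" "y \<in> B" "y \<in> Y" "b \<in> B" "b \<in> {1..n}"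
        unfolding T by blast
      show False using open_parts_intermediate_card[OF Y P] False by simp
    qed
    then show ?thesis using False by simp
  qed
  ultimately show ?thesis by simp
qed

text \<open>Only the number of closing points matters, not their positions. Keeping \<open>f\<close>
  abstract separates the counting from the integrals: the same initial values and recurrence
  determine both.\<close>

lemma sum_open_parts:
  fixes l :: real and f :: "nat \<Rightarrow> nat \<Rightarrow> real"
  assumes f0: "\<And>k. f 0 k = (if k = 0 then 1 else 0)"
    and fSuc: "\<And>n k. f (Suc n) k =
      f n (Suc k) + (if k = 1 then l + 1 else l) * f n k + (if k = 0 then 0 else l * f n (k - 1))"
    and Y: "finite Y" "\<forall>y\<in>Y. n < y"
  shows "(\<Sum>P\<in>open_parts n Y. l ^ card P) = f n (card Y)"
  using Y
proof (induction n arbitrary: Y)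
  case 0
  then show ?case by (simp add: open_parts_0 f0)
next
  case (Suc n)
  have less: "\<forall>y\<in>Y. n < y" "\<forall>y\<in>insert (Suc n) Y. n < y" "\<forall>y\<in>Y - {Min Y}. n < y"
    using Suc.prems by auto
  have notin: "Suc n \<notin> Y" using Suc.prems by auto
  have "card (Y - {Min Y}) = card Y - 1" if "Y \<noteq> {}" using Suc.prems that by simp
  \<comment> \<open>For \<open>card Y = 1\<close> the coefficient \<open>l + 1\<close> combines the
    singleton term \<open>l\<close> with the intermediate term 1.\<close>
  then show ?case
    using Suc.prems less notin
    by (simp add: sum_open_parts_Suc Suc.IH fSuc algebra_simps)
qed

subsection \<open>Moments\<close>

text \<open>By \<open>depth_eq\<close> the depth can be read off at any point of \<open>B\<close>,
  and it is positive iff some block covers that point. Covering and nesting agree because the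
  minimum and maximum of a finite nonempty block serve as witnesses.\<close>

lemma inner_block_iff:
  assumes P: "P \<in> NC n" and B: "B \<in> P"
  shows "inner_block P B \<longleftrightarrow> (\<exists>C\<in>P. \<exists>b\<in>B. nests C b)"
proof -
  have part: "partition_on {1..n} P" using P by (simp add: NC_def)
  have finP: "finite P" using finite_elements[OF _ part] by simp
  have covers: "covers C a \<longleftrightarrow> nests C a" if C: "C \<in> P" for C a
  proof -
    have "C \<subseteq> {1..n}" by (rule partition_on_block_subset[OF part C])
    then have "finite C" by (rule finite_subset) simp
    have "C \<noteq> {}" using part C by (auto simp: partition_on_def)
    then have mem: "Min C \<in> C" "Max C \<in> C" and bound: "\<And>c. c \<in> C \<Longrightarrow> Min C \<le> c \<and> c \<le> Max C"
      using \<open>finite C\<close> by auto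
    have "a \<noteq> Min C \<and> a \<noteq> Max C" if "a \<notin> C" using mem that by blast
    then show ?thesis
      unfolding covers_def nests_def using mem bound
      by (metis le_neq_implies_less le_trans less_imp_le_nat)
  qed
  have "inner_block P B \<longleftrightarrow> (\<exists>C\<in>P. nests C b)" if "b \<in> B" for b
  proof -
    have "inner_block P B \<longleftrightarrow> card {C \<in> P. covers C b} \<noteq> 0"
      unfolding inner_block_def depth_eq[OF P B that] by linarith
    then show ?thesis using finP covers by auto
  qed
  moreover have "B \<noteq> {}" using part B by (auto simp: partition_on_def)
  ultimately show ?thesis by blast
qed

lemma open_parts_empty:
  "open_parts n {} = {P \<in> NC n. \<not> (\<exists>B\<in>P. inner_block P B \<and> card B \<ge> 3)}"
proof (rule set_eqI)
  fix P
  show "P \<in> open_parts n {} \<longleftrightarrow> P \<in> {P \<in> NC n. \<not> (\<exists>B\<in>P. inner_block P B \<and> card B \<ge> 3)}"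
  proof (cases "P \<in> NC n")
    case True
    then show ?thesis
      using inner_block_iff[OF True] by (auto simp: open_parts_def NC_def admissible_def)
  next
    case False
    then show ?thesis by (auto simp: open_parts_def NC_def admissible_def)
  qed
qed

text \<open>A continuous function is bounded on the compact support, hence integrable for the
  probability measure. The vanishing integrals are orthogonality to \<open>cpoly l 0\<close>, the
  constant 1.\<close>

lemma is_cfree_poissonD:
  assumes "is_cfree_poisson l M"
  shows integrable_continuous: "\<And>f. continuous_on UNIV f \<Longrightarrow> integrable M (f :: real \<Rightarrow> real)"
    and integral_cpoly: "k \<noteq> 0 \<Longrightarrow> (\<integral>x. poly (cpoly l k) x \<partial>M) = 0"
    and prob_space_cfree_poisson: "prob_space M"
proof -
  have rd: "real_distribution M" and K: "\<exists>K. compact K \<and> (AE x in M. x \<in> K)"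
    and orth: "orthogonalizing M (cpoly l)"
    using assms by (auto simp: is_cfree_poisson_def compactly_supported_def)
  interpret real_distribution M by fact
  show "prob_space M" by unfold_locales
  show "integrable M f" if f: "continuous_on UNIV f" for f :: "real \<Rightarrow> real"
  proof -
    obtain K where K: "compact K" "AE x in M. x \<in> K" using K by blast
    have "compact (f ` K)" using K f by (intro compact_continuous_image) (auto intro: continuous_on_subset)
    then obtain b where b: "\<And>x. x \<in> K \<Longrightarrow> norm (f x) \<le> b"
      using compact_imp_bounded by (force simp: bounded_iff)
    have "AE x in M. norm (f x) \<le> b" using K(2) by eventually_elim (rule b)
    moreover have "f \<in> borel_measurable M"
      using borel_measurable_continuous_onI[OF f] by simp
    ultimately show ?thesis by (rule integrable_const_bound)
  qed
  show "(\<integral>x. poly (cpoly l k) x \<partial>M) = 0" if "k \<noteq> 0"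
    using orth that unfolding orthogonalizing_def by (auto dest: spec[where x = k] spec[where x = 0])
qed

text \<open>The three-term recurrence solved for the product with \<open>x\<close>, case by case
  along the defining equations. At \<open>k = 0\<close> the last term is switched off explicitly, as
  \<open>k - 1\<close> would be 0 again.\<close>

lemma mult_cpoly:
  "x * poly (cpoly l k) x = poly (cpoly l (Suc k)) x +
     (if k = 1 then l + 1 else l) * poly (cpoly l k) x +
     (if k = 0 then 0 else l * poly (cpoly l (k - 1)) x)"
  by (cases "(l, k)" rule: cpoly.cases) (auto simp: algebra_simps)

lemma moment_eq_sum_open_parts:
  assumes M: "is_cfree_poisson l M"
  shows "moment M n = (\<Sum>P\<in>open_parts n {}. l ^ card P)"
proof -
  define f where "f n k = (\<integral>x. x ^ n * poly (cpoly l k) x \<partial>M)" for n k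
  interpret prob_space M by (rule prob_space_cfree_poisson[OF M])
  have int: "integrable M (\<lambda>x. x ^ n * poly (cpoly l k) x)" for n k
    by (rule integrable_continuous[OF M]) (intro continuous_intros)
  have "f 0 k = (if k = 0 then 1 else 0)" for k
    using integral_cpoly[OF M, of k] by (simp add: f_def prob_space)
  moreover have "f (Suc n) k =
      f n (Suc k) + (if k = 1 then l + 1 else l) * f n k + (if k = 0 then 0 else l * f n (k - 1))" for n k
  proof -
    \<comment> \<open>The case distinction on \<open>k = 0\<close> is moved into the scalar factor,
      so that linearity of the integral applies to all three terms.\<close>
    have "x ^ Suc n * poly (cpoly l k) x = x ^ n * poly (cpoly l (Suc k)) x +
       (if k = 1 then l + 1 else l) * (x ^ n * poly (cpoly l k) x) +
       (if k = 0 then 0 else l) * (x ^ n * poly (cpoly l (k - 1)) x)" for x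
    proof -
      have "x ^ Suc n * poly (cpoly l k) x = x ^ n * (x * poly (cpoly l k) x)" by simp
      then show ?thesis unfolding mult_cpoly by (simp add: algebra_simps)
    qed
    then show ?thesis unfolding f_def using int by simp
  qed
  \<comment> \<open>No block is open at the end, so \<open>k = 0\<close>, and
    \<open>cpoly l 0 = 1\<close> makes the integral the moment.\<close>
  ultimately have "(\<Sum>P\<in>open_parts n {}. l ^ card P) = f n (card ({} :: nat set))"
    by (rule sum_open_parts) auto
  then show ?thesis by (simp add: f_def moment_def)
qed

theorem proposition6p3:
  fixes l :: real and M :: "real measure" and n :: nat
  assumes "l > 0" and "is_cfree_poisson l M" and "n \<ge> 1"
  shows
    "moment M n =
       (\<Sum>P\<in>{P \<in> NC n. \<not> (\<exists>B\<in>P. inner_block P B \<and> card B \<ge> 3)}.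
          (\<Prod>B\<in>{B \<in> P. card B = 1 \<or> card B = 2}. l) *
          (\<Prod>B\<in>{B \<in> P. card B \<ge> 3 \<and> outer_block P B}. l)) \<and>
     moment M n =
       (\<Sum>P\<in>{P \<in> NC n. \<not> (\<exists>B\<in>P. inner_block P B \<and> card B \<ge> 3)}.
          (\<Prod>B\<in>{B \<in> P. (card B = 1 \<or> card B = 2) \<and> inner_block P B}. l) *
          (\<Prod>B\<in>{B \<in> P. outer_block P B}. l)) \<and>
     moment M n = (\<Sum>k=1..n. of_nat (card (NC_12_inner n k)) * l ^ k)"
proof -
  let ?S = "{P \<in> NC n. \<not> (\<exists>B\<in>P. inner_block P B \<and> card B \<ge> 3)}"
  have moment: "moment M n = (\<Sum>P\<in>?S. l ^ card P)"
    using moment_eq_sum_open_parts[OF assms(2)] by (simp only: open_parts_empty)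
  have finS: "finite ?S" using finite_open_parts[of "{}" n] by (simp add: open_parts_empty)
  have part: "partition_on {1..n} P" if "P \<in> ?S" for P using that by (simp add: NC_def)
  have finP: "finite P" if "P \<in> ?S" for P using finite_elements[OF _ part[OF that]] by simp
  have size: "card B = 1 \<or> card B = 2 \<or> 3 \<le> card B" if "P \<in> NC n" "B \<in> P" for P B
  proof -
    have "B \<subseteq> {1..n}" "B \<noteq> {}" using that by (auto simp: NC_def partition_on_def)
    then have "card B \<noteq> 0" using finite_subset[of B "{1..n}"] by simp
    then show ?thesis by linarith
  qed
  have outer: "outer_block P B \<longleftrightarrow> \<not> inner_block P B" for P B
    by (auto simp: outer_block_def inner_block_def)
  \<comment> \<open>Each summand is just \<open>l ^ card P\<close>, distributed over two
    complementary classes of blocks.\<close>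
  have split: "l ^ card P = (\<Prod>B\<in>{B \<in> P. Q B}. l) * (\<Prod>B\<in>{B \<in> P. R B}. l)"
    if "P \<in> ?S" "\<And>B. B \<in> P \<Longrightarrow> R B \<longleftrightarrow> \<not> Q B" for P Q R
  proof -
    have "P = {B \<in> P. Q B} \<union> {B \<in> P. R B}" "{B \<in> P. Q B} \<inter> {B \<in> P. R B} = {}" using that(2) by auto
    then have "card P = card {B \<in> P. Q B} + card {B \<in> P. R B}"
      using card_Un_disjoint[of "{B \<in> P. Q B}" "{B \<in> P. R B}"] finP[OF that(1)] by simp
    then show ?thesis by (simp add: power_add)
  qed
  \<comment> \<open>In \<open>?S\<close> a block of size at least 3 is automatically outer, and an
    inner block has size 1 or 2; so in either formula every block is counted exactly once.\<close>
  have "moment M n = (\<Sum>P\<in>?S. (\<Prod>B\<in>{B \<in> P. card B = 1 \<or> card B = 2}. l) *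
          (\<Prod>B\<in>{B \<in> P. card B \<ge> 3 \<and> outer_block P B}. l))"
    unfolding moment by (intro sum.cong split refl) (use size outer in fastforce)+
  moreover have "moment M n = (\<Sum>P\<in>?S.
          (\<Prod>B\<in>{B \<in> P. (card B = 1 \<or> card B = 2) \<and> inner_block P B}. l) *
          (\<Prod>B\<in>{B \<in> P. outer_block P B}. l))"
    unfolding moment by (intro sum.cong split refl) (use size outer in blast)+
  moreover have "moment M n = (\<Sum>k=1..n. of_nat (card (NC_12_inner n k)) * l ^ k)"
  proof -
    \<comment> \<open>This bound permits grouping by the number of blocks: \<open>n \<ge> 1\<close>
      excludes the empty partition, and nonempty disjoint blocks number at most
      \<open>n\<close>.\<close>
    have "card P \<in> {1..n}" if "P \<in> ?S" for P
    proof -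
      have "card P \<noteq> 0" using finP[OF that] part[OF that] assms(3) by (auto simp: partition_on_def)
      moreover have "card P \<le> n"
      proof -
        have block: "finite B" "card B \<ge> 1" if "B \<in> P" for B
          using size[of P B] \<open>P \<in> ?S\<close> that by (auto intro: card_ge_0_finite)
        have "card P = (\<Sum>B\<in>P. 1)" by simp
        also have "\<dots> \<le> (\<Sum>B\<in>P. card B)" using block by (intro sum_mono)
        also have "\<dots> = n" using product_partition[OF part[OF that] block(1)] by simp
        finally show ?thesis .
      qed
      ultimately show ?thesis by simp
    qed
    then have "moment M n = (\<Sum>k=1..n. \<Sum>P\<in>{P \<in> ?S. card P = k}. l ^ card P)"
      unfolding moment by (intro sum.group[symmetric] finS) auto
    also have "\<dots> = (\<Sum>k=1..n. \<Sum>P\<in>NC_12_inner n k. l ^ k)"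
    proof (intro sum.cong refl)
      \<comment> \<open>Blocks are nonempty, so failing to have size at least 3 means having size 1
        or 2.\<close>
      show "{P \<in> ?S. card P = k} = NC_12_inner n k" for k
        using size by (fastforce simp: NC_12_inner_def)
      show "P \<in> NC_12_inner n k \<Longrightarrow> l ^ card P = l ^ k" for k P
        by (simp add: NC_12_inner_def)
    qed
    finally show ?thesis by simp
  qed
  ultimately show ?thesis by blast
qed

end
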